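(* If $(H_n)$ is a complete PLRS and $r_1$ is its principal root, then $|r_1|\le 2$.
   Context: A positive linear recurrence sequence (PLRS) generated by $[c_1,\ldots,c_L]$, where $L\ge 1$, the $c_i$ are nonnegative integers, $c_1\ge 1$ and $c_L\ge 1$, is the sequence of positive integers $(H_n)_{n\ge1}$ with $H_1=1$, $H_{n+1}=c_1H_n+c_2H_{n-1}+\cdots+c_nH_1+1$ for $1\le n<L$, and $H_{n+1}=c_1H_n+\cdots+c_LH_{n+1-L}$ for $n\ge L$. A sequence of positive integers $(a_i)_{i\ge1}$ is complete if every positive integer $n$ can be written as $n=\sum_{i=1}^\infty \varepsilon_i a_i$ with $\varepsilon_i\in\{0,1\}$; otherwise it is incomplete. The principal root of the PLRS is the unique positive real root of its characteristic polynomial $x^L-\sum_{i=1}^L c_i x^{L-i}$ (this polynomial has exactly one positive root). *)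

theory Defs
  imports "HOL-Analysis.Analysis" "HOL-Computational_Algebra.Polynomial"
begin

text \<open>
  Sequences are indexed from 1: the values at 0 of \<open>c\<close>, \<open>H\<close> and \<open>a\<close>, and of \<open>c\<close> beyond \<open>L\<close>,
  are irrelevant.
\<close>

definition plrs_coeffs :: "nat \<Rightarrow> (nat \<Rightarrow> nat) \<Rightarrow> bool" where
  "plrs_coeffs L c \<longleftrightarrow> L \<ge> 1 \<and> c 1 \<ge> 1 \<and> c L \<ge> 1"

definition is_plrs :: "nat \<Rightarrow> (nat \<Rightarrow> nat) \<Rightarrow> (nat \<Rightarrow> nat) \<Rightarrow> bool" where
  "is_plrs L c H \<longleftrightarrow> plrs_coeffs L c \<and> H 1 = 1 \<and>
     (\<forall>n. 1 \<le> n \<and> n < L \<longrightarrow> H (n + 1) = (\<Sum>i=1..n. c i * H (n + 1 - i)) + 1) \<and>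
     (\<forall>n. n \<ge> L \<longrightarrow> H (n + 1) = (\<Sum>i=1..L. c i * H (n + 1 - i)))"

text \<open>
  The shift by \<^const>\<open>Suc\<close> makes the series range over indices at least 1.
  Convergence in \<^typ>\<open>nat\<close> is with respect to the discrete topology, so the series
  has only finitely many nonzero terms.
\<close>

definition complete_seq :: "(nat \<Rightarrow> nat) \<Rightarrow> bool" where
  "complete_seq a \<longleftrightarrow>
     (\<forall>n\<ge>1. \<exists>\<epsilon> :: nat \<Rightarrow> nat. (\<forall>i. \<epsilon> i \<in> {0, 1}) \<and> (\<lambda>i. \<epsilon> (Suc i) * a (Suc i)) sums n)"

definition plrs_poly :: "nat \<Rightarrow> (nat \<Rightarrow> nat) \<Rightarrow> real poly" where
  "plrs_poly L c = monom 1 L - (\<Sum>i=1..L. monom (real (c i)) (L - i))"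

definition principal_root :: "nat \<Rightarrow> (nat \<Rightarrow> nat) \<Rightarrow> real" where
  "principal_root L c = (THE x. x > 0 \<and> poly (plrs_poly L c) x = 0)"

lemma poly_plrs_poly:
  "poly (plrs_poly L c) x = x ^ L - (\<Sum>i=1..L. real (c i) * x ^ (L - i))"
  by (simp add: plrs_poly_def poly_sum poly_monom)

lemma plrs_poly_root_unique:
  assumes c: "plrs_coeffs L c" and x: "0 < x" and xy: "x < y"
    and rx: "poly (plrs_poly L c) x = 0" and ry: "poly (plrs_poly L c) y = 0"
  shows False
proof -
  have less: "y ^ (L - i) * x ^ L < x ^ (L - i) * y ^ L" if "i \<in> {1..L}" for i
  proof -
    have "x ^ i < y ^ i" using x xy that by (intro power_strict_mono) auto
    moreover have "x ^ L = x ^ (L - i) * x ^ i" "y ^ L = y ^ (L - i) * y ^ i"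
      using that by (simp_all flip: power_add)
    ultimately show ?thesis using x xy by (simp add: mult.left_commute)
  qed
  have "(\<Sum>i=1..L. real (c i) * (y ^ (L - i) * x ^ L))
      < (\<Sum>i=1..L. real (c i) * (x ^ (L - i) * y ^ L))"
  proof (rule sum_strict_mono_ex1)
    show "\<forall>i\<in>{1..L}. real (c i) * (y ^ (L - i) * x ^ L) \<le> real (c i) * (x ^ (L - i) * y ^ L)"
      using less by (intro ballI mult_left_mono) (simp_all add: less_imp_le)
    have "real (c 1) * (y ^ (L - 1) * x ^ L) < real (c 1) * (x ^ (L - 1) * y ^ L)"
      using c less[of 1] by (intro mult_strict_left_mono) (auto simp: plrs_coeffs_def)
    then show "\<exists>i\<in>{1..L}. real (c i) * (y ^ (L - i) * x ^ L) < real (c i) * (x ^ (L - i) * y ^ L)"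
      using c by (intro bexI[of _ 1]) (auto simp: plrs_coeffs_def)
  qed simp
  moreover have "(\<Sum>i=1..L. real (c i) * (y ^ (L - i) * x ^ L)) = y ^ L * x ^ L"
    using ry by (simp add: poly_plrs_poly sum_distrib_right mult.assoc)
  moreover have "(\<Sum>i=1..L. real (c i) * (x ^ (L - i) * y ^ L)) = x ^ L * y ^ L"
    using rx by (simp add: poly_plrs_poly sum_distrib_right mult.assoc)
  ultimately show False by (simp add: mult.commute)
qed

lemma plrs_poly_ex1_root:
  assumes c: "plrs_coeffs L c"
  shows "\<exists>!x. x > 0 \<and> poly (plrs_poly L c) x = 0"
proof -
  define S where "S = (\<Sum>i=1..L. real (c i))"
  have S: "S \<ge> 0" unfolding S_def by (intro sum_nonneg) auto
  have L: "L \<ge> 1" and cL: "c L \<ge> 1" using c by (auto simp: plrs_coeffs_def)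
  have "(\<Sum>i=1..L. real (c i) * 0 ^ (L - i)) = (\<Sum>i=1..L. if i = L then real (c i) else 0)"
    by (rule sum.cong) auto
  also have "\<dots> = real (c L)" using L by simp
  finally have neg: "poly (plrs_poly L c) 0 < 0"
    using L cL by (simp add: poly_plrs_poly zero_power)
  have "(\<Sum>i=1..L. real (c i) * (S + 1) ^ (L - i)) \<le> (\<Sum>i=1..L. real (c i) * (S + 1) ^ (L - 1))"
    using S by (intro sum_mono mult_left_mono power_increasing) auto
  also have "\<dots> = S * (S + 1) ^ (L - 1)" by (simp add: S_def sum_distrib_right)
  also have "\<dots> < (S + 1) * (S + 1) ^ (L - 1)" using S by simp
  also have "\<dots> = (S + 1) ^ L" using L by (simp flip: power_Suc)
  finally have pos: "poly (plrs_poly L c) (S + 1) > 0" by (simp add: poly_plrs_poly)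
  obtain x where "x > 0" "poly (plrs_poly L c) x = 0"
    using poly_IVT_pos[OF _ neg pos] S by auto
  then show ?thesis
    using plrs_poly_root_unique[OF c] by (metis linorder_neqE_linordered_idom)
qed

end

theory Submission
  imports Defs
begin

text \<open>
  A nondecreasing complete sequence satisfies \<open>a n \<le> 2 ^ (n - 1)\<close>, while the recurrence forces
  \<open>H n\<close> to grow at least like a constant times the \<open>n\<close>-th power of the principal root.
\<close>

lemma plrs_coeffs_if_is_plrs: "is_plrs L c H \<Longrightarrow> plrs_coeffs L c"
  by (simp add: is_plrs_def)

text \<open>Since \<open>c 1 \<ge> 1\<close>, the term \<open>i = 1\<close> of the recurrence alone
  contributes at least \<open>H n\<close>.\<close>

lemma plrs_le_Suc:
  assumes "is_plrs L c H" "n \<ge> 1"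
  shows "H n \<le> H (Suc n)"
proof -
  have c: "c 1 \<ge> 1" "L \<ge> 1" using assms by (auto simp: is_plrs_def plrs_coeffs_def)
  \<comment> \<open>The upper limit \<open>m\<close> is left free to serve both regimes of the
    recurrence: \<open>m = n\<close> below \<open>L\<close>, and \<open>m = L\<close>
    afterwards.\<close>
  have sum: "H n \<le> (\<Sum>i=1..m. c i * H (n + 1 - i))" if "m \<ge> 1" for m
  proof -
    have "H n \<le> c 1 * H (n + 1 - 1)" using c by simp
    also have "\<dots> \<le> (\<Sum>i=1..m. c i * H (n + 1 - i))"
      using that by (intro member_le_sum) auto
    finally show ?thesis .
  qed
  show ?thesis
  proof (cases "n < L")
    case True
    then have "H (n + 1) = (\<Sum>i=1..n. c i * H (n + 1 - i)) + 1"
      using assms unfolding is_plrs_def by blast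
    then show ?thesis using sum[OF assms(2)] by simp
  next
    case False
    then have "H (n + 1) = (\<Sum>i=1..L. c i * H (n + 1 - i))"
      using assms unfolding is_plrs_def by simp
    then show ?thesis using sum[OF c(2)] by simp
  qed
qed

lemma plrs_mono:
  assumes "is_plrs L c H" "1 \<le> m" "m \<le> n"
  shows "H m \<le> H n"
  using assms(3)
proof (induction n rule: dec_induct)
  case (step n)
  then show ?case using plrs_le_Suc[OF assms(1), of n] assms(2) by linarith
qed simp

text \<open>If \<open>a (Suc n)\<close> exceeded \<open>2 ^ n\<close>, monotonicity would leave only
  the first \<open>n\<close> terms for representing the number \<open>2 ^ n\<close>, but by
  induction these add up to at most \<open>2 ^ n - 1\<close>.\<close>

lemma complete_seq_le_power2:
  assumes complete: "complete_seq a"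
    and mono: "\<And>m n. 1 \<le> m \<Longrightarrow> m \<le> n \<Longrightarrow> a m \<le> a n"
  shows "a (Suc n) \<le> 2 ^ n"
proof (induction n rule: less_induct)
  case (less n)
  show ?case
  proof (rule ccontr)
    assume "\<not> a (Suc n) \<le> 2 ^ n"
    then have large: "2 ^ n < a (Suc i)" if "i \<ge> n" for i
      using mono[of "Suc n" "Suc i"] that by linarith
    obtain \<epsilon> :: "nat \<Rightarrow> nat" where \<epsilon>: "\<And>i. \<epsilon> i \<in> {0, 1}"
      and sums: "(\<lambda>i. \<epsilon> (Suc i) * a (Suc i)) sums 2 ^ n"
      using complete unfolding complete_seq_def by (metis one_le_numeral one_le_power)
    \<comment> \<open>A single summand, viewed as a sum over \<open>{i}\<close>, is at most the
      whole series \<open>2 ^ n\<close>; as \<open>a (Suc i)\<close> is larger than that, its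
      coefficient must be 0.\<close>
    have zero: "\<epsilon> (Suc i) * a (Suc i) = 0" if "i \<ge> n" for i
    proof -
      have "(\<Sum>j\<in>{i}. \<epsilon> (Suc j) * a (Suc j)) \<le> 2 ^ n"
        unfolding sums_unique[OF sums] by (rule sum_le_suminf[OF sums_summable[OF sums]]) auto
      then show ?thesis using large[OF that] \<epsilon>[of "Suc i"] by auto
    qed
    have "2 ^ n = (\<Sum>i<n. \<epsilon> (Suc i) * a (Suc i))"
      unfolding sums_unique[OF sums] by (rule suminf_finite) (use zero in auto)
    also have "\<dots> \<le> (\<Sum>i<n. 2 ^ i)"
    proof (rule sum_mono)
      fix i assume "i \<in> {..<n}"
      then show "\<epsilon> (Suc i) * a (Suc i) \<le> 2 ^ i"
        using less[of i] \<epsilon>[of "Suc i"] by auto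
    qed
    also have "\<dots> = 2 ^ n - 1"
      by (simp add: mask_eq_sum_exp_nat lessThan_def)
    also have "\<dots> < 2 ^ n" by simp
    finally show False by simp
  qed
qed

text \<open>Beyond \<open>L\<close>, the powers of \<open>r\<close> and the sequence
  \<open>H\<close> obey the same recurrence with nonnegative coefficients, so the inequality
  propagates. The factor \<open>r ^ L\<close> settles the initial range \<open>n \<le> L\<close>,
  where \<open>H n \<ge> 1\<close> suffices.\<close>

lemma plrs_ge_root_power:
  assumes plrs: "is_plrs L c H" and r: "1 \<le> r" and root: "poly (plrs_poly L c) r = 0"
  shows "n \<ge> 1 \<Longrightarrow> r ^ n \<le> r ^ L * real (H n)"
proof (induction n rule: less_induct)
  case (less n)
  show ?case
  proof (cases "n \<le> L")
    case True
    have "1 \<le> H n" using plrs_mono[OF plrs, of 1 n] plrs less.prems by (simp add: is_plrs_def)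
    then have "r ^ L * 1 \<le> r ^ L * real (H n)" using r by (intro mult_left_mono) auto
    then show ?thesis using power_increasing[OF True r] by simp
  next
    case False
    then obtain m where m: "n = Suc m" "m \<ge> L" by (cases n) auto
    \<comment> \<open>Multiplying the characteristic equation by \<open>r ^ (n - L)\<close> gives
      the recurrence for the powers of \<open>r\<close>.\<close>
    have "r ^ n = r ^ (n - L) * r ^ L" using False by (simp flip: power_add)
    also have "r ^ L = (\<Sum>i=1..L. real (c i) * r ^ (L - i))"
      using root by (simp add: poly_plrs_poly)
    also have "r ^ (n - L) * \<dots> = (\<Sum>i=1..L. real (c i) * r ^ (n - i))"
      unfolding sum_distrib_left
    proof (rule sum.cong)
      fix i assume "i \<in> {1..L}"
      then have "n - i = (n - L) + (L - i)" using False by auto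
      then show "r ^ (n - L) * (real (c i) * r ^ (L - i)) = real (c i) * r ^ (n - i)"
        by (simp add: power_add)
    qed simp
    also have "\<dots> \<le> (\<Sum>i=1..L. real (c i) * (r ^ L * real (H (n - i))))"
      \<comment> \<open>The induction hypothesis applies at \<open>n - i\<close> because
        \<open>1 \<le> i \<le> L < n\<close>.\<close>
      using False by (intro sum_mono mult_left_mono less.IH) auto
    also have "\<dots> = r ^ L * real (\<Sum>i=1..L. c i * H (n - i))"
      by (simp add: sum_distrib_left mult.left_commute)
    also have "(\<Sum>i=1..L. c i * H (n - i)) = H n"
      using plrs m by (simp add: is_plrs_def)
    finally show ?thesis .
  qed
qed

theorem lemma4p5:
  fixes L :: nat and c H :: "nat \<Rightarrow> nat" and r\<^sub>1 :: real
  assumes "is_plrs L c H"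
    and "complete_seq H"
    and "r\<^sub>1 = principal_root L c"
  shows "\<bar>r\<^sub>1\<bar> \<le> 2"
proof -
  have pos: "r\<^sub>1 > 0" and root: "poly (plrs_poly L c) r\<^sub>1 = 0"
    using theI'[OF plrs_poly_ex1_root[OF plrs_coeffs_if_is_plrs[OF assms(1)]]]
    unfolding assms(3) principal_root_def by auto
  have "r\<^sub>1 \<le> 2"
  proof (rule ccontr)
    assume "\<not> r\<^sub>1 \<le> 2"
    then have r: "r\<^sub>1 > 2" by simp
    \<comment> \<open>As \<open>r\<^sub>1 / 2 > 1\<close>, its powers outgrow the constant
      \<open>r\<^sub>1 ^ L\<close>; the two bounds on \<open>H (Suc n)\<close> will give the
      opposite inequality for this \<open>n\<close>.\<close>
    then obtain n where n: "r\<^sub>1 ^ L < (r\<^sub>1 / 2) ^ n"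
      using real_arch_pow[of "r\<^sub>1 / 2" "r\<^sub>1 ^ L"] by auto
    \<comment> \<open>One factor \<open>r\<^sub>1\<close> is given away, since the term bounded by
      \<open>2 ^ n\<close> has index \<open>Suc n\<close>.\<close>
    have "r\<^sub>1 ^ n \<le> r\<^sub>1 ^ Suc n" using r by (intro power_increasing) auto
    also have "\<dots> \<le> r\<^sub>1 ^ L * real (H (Suc n))"
      using r by (intro plrs_ge_root_power[OF assms(1) _ root]) auto
    also have "\<dots> \<le> r\<^sub>1 ^ L * 2 ^ n"
    proof (rule mult_left_mono)
      have "H (Suc n) \<le> 2 ^ n"
        using complete_seq_le_power2[OF assms(2)] plrs_mono[OF assms(1)] by blast
      then show "real (H (Suc n)) \<le> 2 ^ n" by (simp flip: of_nat_le_iff)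
    qed (use r in simp)
    finally show False using n by (simp add: power_divide field_simps)
  qed
  with pos show ?thesis by simp
qed

end
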